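(* Let $k\geq 1$, let $G=F_k$ be the free group of rank $k$, let $m\in\mathbb{Z}$ and let $g\in G$. Then there exists $h\in G$ with $g=h^m$ if and only if for every finite-index normal subgroup $K\trianglelefteq G$ there exists $h_K\in G$ with $gK=h_K^mK$ (i.e. $g$ is an $m$-th power in every finite quotient $G/K$). *)

theory Defs
  imports "HOL-Algebra.Algebra"
begin

text \<open>The free group of rank k, realised concretely as the group of reduced words
over the letters (b, i) with i < k; the flag b = True marks the inverse of generator i.\<close>

type_synonym fg_letter = "bool \<times> nat"

definition fg_inv_letter :: "fg_letter \<Rightarrow> fg_letter" where
  "fg_inv_letter x = (\<not> fst x, snd x)"

fun fg_reduced :: "fg_letter list \<Rightarrow> bool" where
  "fg_reduced [] = True"
| "fg_reduced [x] = True"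
| "fg_reduced (x # y # zs) = (y \<noteq> fg_inv_letter x \<and> fg_reduced (y # zs))"

fun fg_red_cons :: "fg_letter \<Rightarrow> fg_letter list \<Rightarrow> fg_letter list" where
  "fg_red_cons x [] = [x]"
| "fg_red_cons x (y # ys) = (if y = fg_inv_letter x then ys else x # y # ys)"

definition fg_reduce :: "fg_letter list \<Rightarrow> fg_letter list" where
  "fg_reduce xs = foldr fg_red_cons xs []"

definition free_group :: "nat \<Rightarrow> fg_letter list monoid" where
  "free_group k = \<lparr> carrier = {w. fg_reduced w \<and> (\<forall>x \<in> set w. snd x < k)},
                    monoid.mult = (\<lambda>v w. fg_reduce (v @ w)),
                    one = [] \<rparr>"

end

theory Submission
  imports Defs
begin

text \<open>After conjugation \<open>g\<close> is a cyclically reduced word \<open>u\<^sup>d\<close> with \<open>u\<close> not a proper power. A circle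
  labelled by \<open>u\<^sup>n\<close> is a partial permutation representation; complete it to permutations of its
  vertex set and let \<open>Q\<close> be the resulting finite quotient (as a Cayley graph). Weight the edges of \<open>Q\<close> by
  1 along the loop read by the powers of \<open>u\<close> from the identity, by -1 against it, and by 0 elsewhere; adding up weights
  modulo a large \<open>N\<close> gives a finite cyclic cover of \<open>Q\<close>. If \<open>g = h\<^sup>m\<close> on this cover then \<open>h\<close> commutes
  with \<open>g\<close> there, so a long power of \<open>g\<close> read from \<open>h\<close> has the same weight as when read from the
  identity. That weight is maximal for its length, so the path stays on the loop, and as \<open>u\<close> is not
  a proper power, \<open>h\<close> is a power of \<open>u\<close> in \<open>Q\<close>. On the circle, \<open>g = h\<^sup>m\<close> becomes a congruence
  \<open>d = m y\<close> modulo \<open>n\<close>, and \<open>n = |m|\<close> (or \<open>n = d + 1\<close> if \<open>m = 0\<close>) yields that \<open>m\<close> divides \<open>d\<close>.\<close>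

section \<open>The group of reduced words\<close>

lemma fg_inv_letter_inv [simp]: "fg_inv_letter (fg_inv_letter x) = x"
  by (simp add: fg_inv_letter_def)

lemma fg_inv_letter_neq [simp]: "fg_inv_letter x \<noteq> x" "x \<noteq> fg_inv_letter x"
  by (auto simp: fg_inv_letter_def prod_eq_iff)

lemma snd_fg_inv_letter [simp]: "snd (fg_inv_letter x) = snd x"
  by (simp add: fg_inv_letter_def)

lemma fg_reduced_Cons:
  "fg_reduced (x # w) \<longleftrightarrow> fg_reduced w \<and> (w \<noteq> [] \<longrightarrow> hd w \<noteq> fg_inv_letter x)"
  by (cases w) auto

lemma fg_reduced_append:
  "fg_reduced (v @ w) \<longleftrightarrow> fg_reduced v \<and> fg_reduced w \<and>
     (v \<noteq> [] \<and> w \<noteq> [] \<longrightarrow> hd w \<noteq> fg_inv_letter (last v))"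
  by (induction v) (auto simp: fg_reduced_Cons hd_append)

lemma fg_reduced_red_cons: "fg_reduced w \<Longrightarrow> fg_reduced (fg_red_cons x w)"
  by (cases w) (auto simp: fg_reduced_Cons)

lemma set_fg_red_cons: "set (fg_red_cons x w) \<subseteq> insert x (set w)"
  by (cases w) auto

lemma fg_red_cons_reduced: "fg_reduced (x # w) \<Longrightarrow> fg_red_cons x w = x # w"
  by (cases w) auto

lemma fg_reduced_reduce: "fg_reduced (fg_reduce w)"
  by (induction w) (auto simp: fg_reduce_def fg_reduced_red_cons)

lemma set_fg_reduce: "set (fg_reduce w) \<subseteq> set w"
proof (induction w)
  case (Cons x w)
  then show ?case
    using set_fg_red_cons[of x "fg_reduce w"] by (auto simp: fg_reduce_def)
qed (simp add: fg_reduce_def)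

lemma fg_reduce_reduced: "fg_reduced w \<Longrightarrow> fg_reduce w = w"
proof (induction w)
  case (Cons x w)
  then have "fg_reduced w" by (simp add: fg_reduced_Cons)
  with Cons show ?case by (simp add: fg_reduce_def fg_red_cons_reduced)
qed (simp add: fg_reduce_def)

lemma fg_reduce_append: "fg_reduce (v @ w) = foldr fg_red_cons v (fg_reduce w)"
  by (simp add: fg_reduce_def)

definition fg_inv_word :: "fg_letter list \<Rightarrow> fg_letter list" where
  "fg_inv_word w = rev (map fg_inv_letter w)"

text \<open>An action of the free group on \<open>S\<close>, given on letters. As
  \<open>act_inv\<close> also covers inverse letters, each letter permutes \<open>S\<close>. With
  \<open>foldr\<close> the last letter of a word acts first, so concatenation acts as
  composition.\<close>

locale letter_action =
  fixes S :: "'a set" and a :: "fg_letter \<Rightarrow> 'a \<Rightarrow> 'a"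
  assumes act_closed: "p \<in> S \<Longrightarrow> a x p \<in> S"
    and act_inv: "p \<in> S \<Longrightarrow> a (fg_inv_letter x) (a x p) = p"
begin

lemma act_inv': "p \<in> S \<Longrightarrow> a x (a (fg_inv_letter x) p) = p"
  using act_inv[of p "fg_inv_letter x"] by simp

lemma foldr_closed: "p \<in> S \<Longrightarrow> foldr a w p \<in> S"
  by (induction w) (auto simp: act_closed)

lemma foldr_red_cons: "p \<in> S \<Longrightarrow> foldr a (fg_red_cons x w) p = a x (foldr a w p)"
  by (cases w) (auto simp: act_inv' foldr_closed)

text \<open>A letter and its inverse cancel in the action as well, so reduction never changes how a
  word acts.\<close>

lemma foldr_reduce: "p \<in> S \<Longrightarrow> foldr a (fg_reduce w) p = foldr a w p"
  by (induction w) (auto simp: fg_reduce_def foldr_red_cons)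

lemma foldr_inv_word: "p \<in> S \<Longrightarrow> foldr a (fg_inv_word w) (foldr a w p) = p"
  by (induction w) (auto simp: fg_inv_word_def act_inv foldr_closed)

lemma foldr_free_mult:
  "p \<in> S \<Longrightarrow> foldr a (v \<otimes>\<^bsub>free_group k\<^esub> w) p = foldr a v (foldr a w p)"
  by (simp add: free_group_def foldr_reduce)

end

text \<open>The van der Waerden trick: letters act on reduced words by cancelling multiplication, so
  associativity of the product comes from associativity of composition.\<close>

interpretation red_cons: letter_action "Collect fg_reduced" fg_red_cons
proof
  fix p x assume "p \<in> Collect fg_reduced"
  then have p: "fg_reduced p" by simp
  then show "fg_red_cons x p \<in> Collect fg_reduced" by (simp add: fg_reduced_red_cons)
  show "fg_red_cons (fg_inv_letter x) (fg_red_cons x p) = p"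
    using p by (cases p) (auto simp: fg_red_cons_reduced)
qed

lemma carrier_free_group:
  "w \<in> carrier (free_group k) \<longleftrightarrow> fg_reduced w \<and> (\<forall>x\<in>set w. snd x < k)"
  by (simp add: free_group_def)

lemma mult_free_group: "v \<otimes>\<^bsub>free_group k\<^esub> w = fg_reduce (v @ w)"
  by (simp add: free_group_def)

lemma mult_free_group_reduced:
  "fg_reduced w \<Longrightarrow> v \<otimes>\<^bsub>free_group k\<^esub> w = foldr fg_red_cons v w"
  by (simp add: mult_free_group fg_reduce_append fg_reduce_reduced)

lemma one_free_group: "\<one>\<^bsub>free_group k\<^esub> = []"
  by (simp add: free_group_def)

lemma group_free_group: "group (free_group k)"
proof (rule groupI)
  show "u \<otimes>\<^bsub>free_group k\<^esub> v \<otimes>\<^bsub>free_group k\<^esub> w = u \<otimes>\<^bsub>free_group k\<^esub> (v \<otimes>\<^bsub>free_group k\<^esub> w)"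
    if "w \<in> carrier (free_group k)" for u v w
    using that
    by (simp add: mult_free_group_reduced carrier_free_group red_cons.foldr_free_mult
        red_cons.foldr_closed[simplified])
  show "\<exists>v\<in>carrier (free_group k). v \<otimes>\<^bsub>free_group k\<^esub> w = \<one>\<^bsub>free_group k\<^esub>"
    if "w \<in> carrier (free_group k)" for w
  proof (intro bexI)
    have "fg_reduce w = w" using that by (simp add: carrier_free_group fg_reduce_reduced)
    then have "foldr fg_red_cons w [] = w" by (simp add: fg_reduce_def)
    then show "fg_reduce (fg_inv_word w) \<otimes>\<^bsub>free_group k\<^esub> w = \<one>\<^bsub>free_group k\<^esub>"
      using red_cons.foldr_inv_word[of "[]" w] that
      by (simp add: mult_free_group one_free_group fg_reduce_append red_cons.foldr_reduce
          \<open>fg_reduce w = w\<close> carrier_free_group)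
    show "fg_reduce (fg_inv_word w) \<in> carrier (free_group k)"
      using that set_fg_reduce[of "fg_inv_word w"]
      by (fastforce simp: carrier_free_group fg_reduced_reduce fg_inv_word_def)
  qed
qed (use set_fg_reduce in \<open>fastforce simp: carrier_free_group mult_free_group one_free_group
      fg_reduced_reduce fg_reduce_reduced\<close>)+

interpretation free: group "free_group k" for k
  by (rule group_free_group)

lemma fg_inv_word_mult:
  "w \<in> carrier (free_group k) \<Longrightarrow> fg_inv_word w \<otimes>\<^bsub>free_group k\<^esub> w = \<one>\<^bsub>free_group k\<^esub>"
  using red_cons.foldr_inv_word[of "[]" w]
  by (simp add: mult_free_group one_free_group fg_reduce_def)

lemma inv_fg_letter:
  assumes "snd x < k"
  shows "inv\<^bsub>free_group k\<^esub> [x] = [fg_inv_letter x]"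
  using assms fg_inv_word_mult[of "[x]" k]
  by (intro free.inv_equality) (auto simp: carrier_free_group fg_inv_word_def)

section \<open>Finite quotients from actions on finite sets\<close>

context letter_action
begin

text \<open>The inverse word acts as the inverse map. Restriction makes the map extensional, as
  \<open>Bij S\<close> demands.\<close>

lemma foldr_Bij: "restrict (foldr a w) S \<in> Bij S"
proof -
  have "bij_betw (foldr a w) S S"
  proof (rule bij_betw_byWitness)
    show "\<forall>p\<in>S. foldr a (fg_inv_word w) (foldr a w p) = p"
      by (simp add: foldr_inv_word)
    have "fg_inv_word (fg_inv_word w) = w"
      by (simp add: fg_inv_word_def rev_map o_def)
    then show "\<forall>p\<in>S. foldr a w (foldr a (fg_inv_word w) p) = p"
      using foldr_inv_word[of _ "fg_inv_word w"] by simp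
  qed (auto simp: foldr_closed)
  then have "bij_betw (restrict (foldr a w) S) S S"
    by (subst bij_betw_cong[of S _ "foldr a w"]) auto
  then show ?thesis by (simp add: Bij_def)
qed

lemma group_hom_BijGroup:
  "group_hom (free_group k) (BijGroup S) (\<lambda>w. restrict (foldr a w) S)"
  by (intro group_hom.intro group_hom_axioms.intro group_free_group group_BijGroup homI)
    (auto simp: BijGroup_def foldr_Bij compose_def foldr_free_mult foldr_closed
       intro!: restrict_ext)

end

text \<open>For negative \<open>m\<close> the inverse of the root is used. With the converse below,
  this lets the main argument work with the exponent \<open>nat \<bar>m\<bar>\<close>.\<close>

lemma (in group) int_pow_eq_nat_pow:
  assumes "h \<in> carrier G"
  shows "\<exists>h'\<in>carrier G. h [^] (m :: int) = h' [^] nat \<bar>m\<bar>"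
proof (cases "m \<ge> 0")
  case True
  then have "h [^] m = h [^] nat \<bar>m\<bar>" by (metis abs_of_nonneg int_pow_int nat_0_le)
  then show ?thesis using assms by blast
next
  case False
  then have "m = - int (nat \<bar>m\<bar>)" by simp
  then have "h [^] m = inv h [^] nat \<bar>m\<bar>"
    using assms by (metis int_pow_neg_int nat_pow_inv)
  then show ?thesis using assms by blast
qed

lemma (in group) nat_pow_eq_int_pow:
  assumes "h \<in> carrier G"
  shows "\<exists>h'\<in>carrier G. h [^] nat \<bar>m\<bar> = h' [^] (m :: int)"
proof (cases "m \<ge> 0")
  case True
  then have "h [^] m = h [^] nat \<bar>m\<bar>" by (metis abs_of_nonneg int_pow_int nat_0_le)
  then show ?thesis using assms by metis
next
  case False
  then have "m = - int (nat \<bar>m\<bar>)" by simp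
  then have "inv h [^] m = h [^] nat \<bar>m\<bar>"
    using assms by (metis int_pow_neg_int nat_pow_inv inv_closed inv_inv)
  then show ?thesis using assms by (metis inv_closed)
qed

definition power_in_finite_quotients :: "nat \<Rightarrow> int \<Rightarrow> fg_letter list \<Rightarrow> bool" where
  "power_in_finite_quotients k m g \<longleftrightarrow>
     (\<forall>K. K \<lhd> free_group k \<and> finite (rcosets\<^bsub>free_group k\<^esub> K) \<longrightarrow>
        (\<exists>hK \<in> carrier (free_group k).
           g <#\<^bsub>free_group k\<^esub> K = (hK [^]\<^bsub>free_group k\<^esub> m) <#\<^bsub>free_group k\<^esub> K))"

text \<open>The kernel of the action has finite index, since the quotient by it embeds in the finite
  group of permutations of \<open>S\<close>. A root of \<open>g\<close> modulo the kernel is a root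
  in the action.\<close>

lemma (in letter_action) power_on_finite_action:
  assumes "finite S" "power_in_finite_quotients k m g" "g \<in> carrier (free_group k)"
  shows "\<exists>h\<in>carrier (free_group k). \<forall>p\<in>S. foldr a g p = foldr a (h [^]\<^bsub>free_group k\<^esub> nat \<bar>m\<bar>) p"
proof -
  define \<phi> where "\<phi> = (\<lambda>w. restrict (foldr a w) S)"
  interpret \<phi>: group_hom "free_group k" "BijGroup S" \<phi>
    unfolding \<phi>_def by (rule group_hom_BijGroup)
  define K where "K = kernel (free_group k) (BijGroup S) \<phi>"
  have "finite (carrier (BijGroup S))"
  proof (rule finite_subset)
    show "carrier (BijGroup S) \<subseteq> S \<rightarrow>\<^sub>E S"
      by (auto simp: BijGroup_def PiE_def Bij_imp_extensional dest: Bij_imp_funcset)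
  qed (use assms(1) in \<open>simp add: finite_PiE\<close>)
  moreover have "(\<lambda>C. the_elem (\<phi> ` C)) ` carrier (free_group k Mod K) \<subseteq> carrier (BijGroup S)"
    using \<phi>.FactGroup_the_elem_mem by (auto simp: K_def)
  ultimately have "finite (carrier (free_group k Mod K))"
    using \<phi>.FactGroup_inj_on inj_on_finite unfolding K_def by blast
  then have "finite (rcosets\<^bsub>free_group k\<^esub> K)" by (simp add: FactGroup_def)
  moreover have "K \<lhd> free_group k" unfolding K_def by (rule \<phi>.normal_kernel)
  ultimately obtain h where h: "h \<in> carrier (free_group k)"
    "g <#\<^bsub>free_group k\<^esub> K = (h [^]\<^bsub>free_group k\<^esub> m) <#\<^bsub>free_group k\<^esub> K"
    using assms(2) unfolding power_in_finite_quotients_def by blast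
  have "\<one>\<^bsub>free_group k\<^esub> \<in> K" by (simp add: K_def kernel_def)
  then have "g \<in> g <#\<^bsub>free_group k\<^esub> K"
    using assms(3) unfolding l_coset_def by (force)
  then obtain c where c: "c \<in> K" "g = (h [^]\<^bsub>free_group k\<^esub> m) \<otimes>\<^bsub>free_group k\<^esub> c"
    unfolding h(2) by (auto simp: l_coset_def)
  have "foldr a g p = foldr a (h [^]\<^bsub>free_group k\<^esub> m) p" if "p \<in> S" for p
  proof -
    have "\<phi> c p = p" using c(1) that by (simp add: K_def kernel_def BijGroup_def)
    then have "foldr a c p = p" using that by (simp add: \<phi>_def)
    then show ?thesis using c(2) that by (simp add: foldr_free_mult)
  qed
  moreover obtain h' where "h' \<in> carrier (free_group k)"
      "h [^]\<^bsub>free_group k\<^esub> m = h' [^]\<^bsub>free_group k\<^esub> nat \<bar>m\<bar>"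
    using free.int_pow_eq_nat_pow[OF h(1)] by blast
  ultimately show ?thesis by auto
qed

section \<open>Conjugation, and completing partial injections to permutations\<close>

lemma (in group) int_pow_conjugate:
  assumes "s \<in> carrier G" "h \<in> carrier G"
  shows "(s \<otimes> h \<otimes> inv s) [^] (m :: int) = s \<otimes> h [^] m \<otimes> inv s"
proof -
  have "(\<lambda>y. s \<otimes> y \<otimes> inv s) \<in> hom G G"
    using assms(1) by (intro homI) (auto simp: m_assoc inv_solve_left)
  from hom_int_pow[OF this assms(2), of m] show ?thesis
    using is_group by simp
qed

text \<open>A root of the conjugate modulo \<open>K\<close> is conjugated back by \<open>t\<close>,
  the inverse of \<open>s\<close>; normality moves \<open>s\<close> from one side of
  \<open>K\<close> to the other.\<close>

lemma power_in_finite_quotients_conjugate: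
  fixes k :: nat and m :: int
  defines "G \<equiv> free_group k"
  assumes s: "s \<in> carrier G" and g: "g \<in> carrier G"
    and pow: "power_in_finite_quotients k m (s \<otimes>\<^bsub>G\<^esub> g \<otimes>\<^bsub>G\<^esub> inv\<^bsub>G\<^esub> s)"
  shows "power_in_finite_quotients k m g"
  unfolding power_in_finite_quotients_def G_def[symmetric]
proof safe
  fix K assume K: "K \<lhd> G" "finite (rcosets\<^bsub>G\<^esub> K)"
  interpret G: group G unfolding G_def by (rule group_free_group)
  interpret K: normal K G by (rule K(1))
  obtain h where h: "h \<in> carrier G"
    "(s \<otimes>\<^bsub>G\<^esub> g \<otimes>\<^bsub>G\<^esub> inv\<^bsub>G\<^esub> s) <#\<^bsub>G\<^esub> K = (h [^]\<^bsub>G\<^esub> m) <#\<^bsub>G\<^esub> K"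
    using pow K unfolding power_in_finite_quotients_def G_def by blast
  define t where "t = inv\<^bsub>G\<^esub> s"
  have t: "t \<in> carrier G" "inv\<^bsub>G\<^esub> t = s" using s by (auto simp: t_def)
  have assoc: "(t \<otimes>\<^bsub>G\<^esub> y) <#\<^bsub>G\<^esub> (K #>\<^bsub>G\<^esub> s) = t <#\<^bsub>G\<^esub> ((y <#\<^bsub>G\<^esub> K) #>\<^bsub>G\<^esub> s)"
    if "y \<in> carrier G" for y
    using that s t(1) K.subset
    by (simp add: G.coset_assoc G.lcos_m_assoc[symmetric] G.r_coset_subset_G G.l_coset_subset_G)
  have "(t \<otimes>\<^bsub>G\<^esub> h \<otimes>\<^bsub>G\<^esub> inv\<^bsub>G\<^esub> t) [^]\<^bsub>G\<^esub> m <#\<^bsub>G\<^esub> K = (t \<otimes>\<^bsub>G\<^esub> h [^]\<^bsub>G\<^esub> m \<otimes>\<^bsub>G\<^esub> s) <#\<^bsub>G\<^esub> K"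
    using G.int_pow_conjugate[OF t(1) h(1)] t by simp
  also have "\<dots> = (t \<otimes>\<^bsub>G\<^esub> h [^]\<^bsub>G\<^esub> m) <#\<^bsub>G\<^esub> (K #>\<^bsub>G\<^esub> s)"
    using s t h K.coset_eq K.subset by (simp add: G.lcos_m_assoc)
  also have "\<dots> = t <#\<^bsub>G\<^esub> ((h [^]\<^bsub>G\<^esub> m <#\<^bsub>G\<^esub> K) #>\<^bsub>G\<^esub> s)"
    using assoc[of "h [^]\<^bsub>G\<^esub> m"] h(1) by simp
  also have "\<dots> = t <#\<^bsub>G\<^esub> (((s \<otimes>\<^bsub>G\<^esub> g \<otimes>\<^bsub>G\<^esub> t) <#\<^bsub>G\<^esub> K) #>\<^bsub>G\<^esub> s)"
    using h(2) t_def by simp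
  also have "\<dots> = (t \<otimes>\<^bsub>G\<^esub> (s \<otimes>\<^bsub>G\<^esub> g \<otimes>\<^bsub>G\<^esub> t)) <#\<^bsub>G\<^esub> (K #>\<^bsub>G\<^esub> s)"
    using assoc[of "s \<otimes>\<^bsub>G\<^esub> g \<otimes>\<^bsub>G\<^esub> t"] s g t(1) by simp
  also have "\<dots> = (t \<otimes>\<^bsub>G\<^esub> (s \<otimes>\<^bsub>G\<^esub> g \<otimes>\<^bsub>G\<^esub> t) \<otimes>\<^bsub>G\<^esub> s) <#\<^bsub>G\<^esub> K"
    using s t g K.coset_eq K.subset by (simp add: G.lcos_m_assoc)
  also have "t \<otimes>\<^bsub>G\<^esub> (s \<otimes>\<^bsub>G\<^esub> g \<otimes>\<^bsub>G\<^esub> t) \<otimes>\<^bsub>G\<^esub> s = g"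
    using s g by (simp add: t_def G.m_assoc[symmetric]) (simp add: G.m_assoc)
  finally show "\<exists>hK\<in>carrier G. g <#\<^bsub>G\<^esub> K = hK [^]\<^bsub>G\<^esub> m <#\<^bsub>G\<^esub> K"
    using t h(1) by (intro bexI[of _ "t \<otimes>\<^bsub>G\<^esub> h \<otimes>\<^bsub>G\<^esub> inv\<^bsub>G\<^esub> t"]) auto
qed

text \<open>Domain and range of \<open>R\<close> have the same finite cardinality, hence so do their
  complements, and any bijection between these completes \<open>R\<close>.\<close>

lemma extend_partial_injection:
  assumes "finite V" "R \<subseteq> V \<times> V" "single_valued R" "single_valued (R\<inverse>)"
  obtains \<pi> where "bij_betw \<pi> V V" "\<And>x y. (x, y) \<in> R \<Longrightarrow> \<pi> x = y"
proof -
  define f where "f x = (THE y. (x, y) \<in> R)" for x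
  have f: "f x = y" if "(x, y) \<in> R" for x y
    unfolding f_def using that assms(3) by (auto dest: single_valuedD)
  have "bij_betw f (Domain R) (Range R)"
    unfolding bij_betw_def
  proof
    show "inj_on f (Domain R)"
    proof (rule inj_onI)
      fix x x' assume "x \<in> Domain R" "x' \<in> Domain R" "f x = f x'"
      moreover from this obtain y y' where "(x, y) \<in> R" "(x', y') \<in> R" by (meson DomainE)
      ultimately have "(x, y) \<in> R" "(x', y) \<in> R" using f by metis+
      then show "x = x'" using assms(4) by (auto dest: single_valuedD)
    qed
    show "f ` Domain R = Range R" using f by (force simp: image_iff)
  qed
  moreover have sub: "Domain R \<subseteq> V" "Range R \<subseteq> V" using assms(2) by auto
  moreover from calculation have "card (V - Domain R) = card (V - Range R)"
    using assms(1) by (simp add: bij_betw_same_card card_Diff_subset finite_subset)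
  then obtain g where "bij_betw g (V - Domain R) (V - Range R)"
    using finite_same_card_bij[of "V - Domain R" "V - Range R"] assms(1) by auto
  ultimately have bij: "bij_betw (\<lambda>x. if x \<in> Domain R then f x else g x)
      (Domain R \<union> (V - Domain R)) (Range R \<union> (V - Range R))"
    by (intro bij_betw_disjoint_Un) auto
  have "Domain R \<union> (V - Domain R) = V" "Range R \<union> (V - Range R) = V"
    using sub by auto
  from that[OF bij[unfolded this]] f show ?thesis by (metis DomainI)
qed

section \<open>Detecting loops by a covering action\<close>

text \<open>Words act from the right end, so the letter \<open>s j\<close> is read while moving from
  \<open>P (Suc j)\<close> to \<open>P j\<close>.\<close>

lemma mod_Suc_cancel: "Suc i mod r = Suc j mod r \<Longrightarrow> i mod r = j mod (r::nat)"
  by (auto simp: mod_Suc split: if_splits)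

text \<open>The path may revisit vertices, but by \<open>P_inj\<close> a vertex determines its
  position modulo \<open>r\<close> and hence, by \<open>s_periodic\<close>, the labels next to
  it.\<close>

locale labelled_loop = letter_action S a for S :: "'a set" and a +
  fixes s :: "nat \<Rightarrow> fg_letter" and P :: "nat \<Rightarrow> 'a" and r :: nat
  assumes s_periodic: "i mod r = j mod r \<Longrightarrow> s i = s j"
    and s_reduced: "s (Suc j) \<noteq> fg_inv_letter (s j)"
    and P_closed: "P j \<in> S"
    and P_step: "a (s j) (P (Suc j)) = P j"
    and P_inj: "P i = P j \<Longrightarrow> i mod r = j mod r"
begin

lemma P_step_inv: "a (fg_inv_letter (s j)) (P j) = P (Suc j)"
  using act_inv[OF P_closed, of "s j" "Suc j"] by (simp add: P_step)

lemma P_Suc_cong: "P i = P j \<Longrightarrow> P (Suc i) = P (Suc j)"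
  using P_step_inv s_periodic[OF P_inj] by metis

lemma P_pred_cong: "P (Suc i) = P (Suc j) \<Longrightarrow> P i = P j"
proof -
  assume eq: "P (Suc i) = P (Suc j)"
  then have "Suc i mod r = Suc j mod r" by (rule P_inj)
  then have "i mod r = j mod r"
    by (rule mod_Suc_cancel)
  then have "s i = s j" by (rule s_periodic)
  then show "P i = P j" using eq P_step by metis
qed

lemma foldr_loop: "i \<le> l \<Longrightarrow> foldr a (map s [i..<l]) (P l) = P i"
  by (induction l) (auto simp: le_Suc_eq P_step)

text \<open>A 1-cochain on the graph of the action: \<open>x\<close> and \<open>p\<close> stand for
  the edge that leaves \<open>p\<close> with label \<open>x\<close>.\<close>

definition weight :: "fg_letter \<Rightarrow> 'a \<Rightarrow> int" where
  "weight x p = (if \<exists>j. x = s j \<and> p = P (Suc j) then 1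
                 else if \<exists>j. x = fg_inv_letter (s j) \<and> p = P j then -1 else 0)"

lemma weight_loop: "weight (s j) (P (Suc j)) = 1"
  by (auto simp: weight_def)

lemma abs_weight_le: "\<bar>weight x p\<bar> \<le> 1"
  by (simp add: weight_def)

lemma weight_inv:
  assumes p: "p \<in> S"
  shows "weight (fg_inv_letter x) (a x p) = - weight x p"
proof -
  have fwd: "(\<exists>j. fg_inv_letter x = fg_inv_letter (s j) \<and> a x p = P j) \<longleftrightarrow>
        (\<exists>j. x = s j \<and> p = P (Suc j))"
    by (metis act_inv[OF p] P_step P_step_inv fg_inv_letter_inv)
  have bwd: "(\<exists>j. fg_inv_letter x = s j \<and> a x p = P (Suc j)) \<longleftrightarrow>
        (\<exists>j. x = fg_inv_letter (s j) \<and> p = P j)"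
    by (metis act_inv[OF p] P_step P_step_inv fg_inv_letter_inv)
  \<comment> \<open>An edge lying on the loop in both directions would make two consecutive labels
    mutually inverse, against \<open>s_reduced\<close>.\<close>
  have excl: "\<not> ((\<exists>j. x = s j \<and> p = P (Suc j)) \<and> (\<exists>j. x = fg_inv_letter (s j) \<and> p = P j))"
    by (metis P_inj s_periodic s_reduced fg_inv_letter_inv)
  show ?thesis unfolding weight_def fwd bwd using excl by auto
qed

fun path_weight :: "fg_letter list \<Rightarrow> 'a \<Rightarrow> int" where
  "path_weight [] p = 0"
| "path_weight (x # w) p = path_weight w p + weight x (foldr a w p)"

lemma path_weight_append:
  "path_weight (v @ w) p = path_weight w p + path_weight v (foldr a w p)"
  by (induction v) auto

lemma abs_path_weight_le: "\<bar>path_weight w p\<bar> \<le> int (length w)"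
proof (induction w)
  case (Cons x w)
  then show ?case using abs_weight_le[of x "foldr a w p"] by simp
qed simp

lemma path_weight_loop: "path_weight (map s [0..<l]) (P l) = int l"
proof (induction l)
  case (Suc l)
  then show ?case by (simp add: path_weight_append P_step weight_loop)
qed simp

lemma weight_eq_1_if_full:
  assumes "path_weight (v @ x # w) p = int (length (v @ x # w))"
  shows "weight x (foldr a w p) = 1"
proof -
  have "path_weight (v @ x # w) p =
      path_weight w p + weight x (foldr a w p) + path_weight v (foldr a (x # w) p)"
    by (simp add: path_weight_append)
  moreover have "path_weight w p \<le> int (length w)"
    "path_weight v (foldr a (x # w) p) \<le> int (length v)" "weight x (foldr a w p) \<le> 1"
    using abs_path_weight_le[of w p] abs_path_weight_le[of v "foldr a (x # w) p"]
      abs_weight_le[of x "foldr a w p"] by linarith+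
  ultimately show ?thesis using assms by simp
qed

text \<open>Every step has weight at most 1, so a path of maximal weight never leaves the loop and
  always follows its direction.\<close>

lemma full_weight_path:
  assumes l: "r dvd l" "l > 0" and r: "r > 0"
    and least: "\<And>i. (\<And>j. s (i + j) = s j) \<Longrightarrow> r dvd i"
    and full: "path_weight (map s [0..<l]) q = int l"
  shows "\<exists>j. r dvd j \<and> q = P j"
proof -
  have full_step: "weight (s i) (foldr a (map s [Suc i..<l]) q) = 1" if "i < l" for i
  proof -
    have "[0..<l] = [0..<i] @ i # [Suc i..<l]"
      using that upt_add_eq_append[of 0 i "l - i"] by (simp add: upt_conv_Cons)
    then have "map s [0..<l] = map s [0..<i] @ s i # map s [Suc i..<l]" by simp
    then show ?thesis
      using weight_eq_1_if_full full by (metis length_map length_upt diff_zero)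
  qed
  have on_loop: "\<exists>j. x = s j \<and> p = P (Suc j)" if "weight x p = 1" for x p
    using that by (auto simp: weight_def split: if_splits)
  \<comment> \<open>The last letter of the word is read first, so its weight 1 already places
    \<open>q\<close> on the loop.\<close>
  obtain l' where l': "l = Suc l'" using l(2) by (cases l) auto
  obtain j0 where j0: "q = P j0" using on_loop[OF full_step[of l']] l' by auto
  \<comment> \<open>Downward induction from \<open>l\<close>, as letters are read from the right.
    The position is controlled only modulo \<open>r\<close>, and \<open>r dvd l\<close> gives the
    start.\<close>
  have walk: "\<exists>b. foldr a (map s [i..<l]) q = P b \<and> b mod r = (j0 + i) mod r" if "i \<le> l" for i
    using that
  proof (induction rule: inc_induct)
    case base
    have "j0 mod r = (j0 + l) mod r" using l(1) by auto
    then show ?case using j0 by auto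
  next
    case (step i)
    then obtain b where b: "foldr a (map s [Suc i..<l]) q = P b" "b mod r = (j0 + Suc i) mod r"
      by blast
    obtain j where j: "s i = s j" "P b = P (Suc j)"
      using on_loop[OF full_step[of i]] step.hyps b(1) by auto
    have "foldr a (map s [i..<l]) q = P j"
      using step.hyps j b(1) by (simp add: upt_conv_Cons P_step)
    moreover have "Suc j mod r = Suc (j0 + i) mod r"
      using P_inj[OF j(2)] b(2) by simp
    then have "j mod r = (j0 + i) mod r"
      by (rule mod_Suc_cancel)
    ultimately show ?case by blast
  qed
  \<comment> \<open>The letter \<open>s i\<close> of the word must agree with the loop label at the
    place reached, which is \<open>s (j0 + i)\<close>.\<close>
  have shift: "s (j0 + i) = s i" if "i < l" for i
  proof -
    obtain b where b: "foldr a (map s [Suc i..<l]) q = P b" "b mod r = (j0 + Suc i) mod r"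
      using walk[of "Suc i"] \<open>i < l\<close> by auto
    obtain j where j: "s i = s j" "P b = P (Suc j)"
      using on_loop[OF full_step[OF \<open>i < l\<close>]] b(1) by auto
    have "Suc j mod r = Suc (j0 + i) mod r"
      using P_inj[OF j(2)] b(2) by simp
    then have "j mod r = (j0 + i) mod r"
      by (rule mod_Suc_cancel)
    then show ?thesis using j(1) s_periodic by metis
  qed
  \<comment> \<open>Since \<open>r \<le> l\<close>, the indices below \<open>l\<close> cover a full
    period. So \<open>j0\<close> is a period of \<open>s\<close>, and \<open>least\<close> gives
    \<open>r dvd j0\<close>.\<close>
  have "s (j0 + j) = s j" for j
  proof -
    have "j mod r < l" using r l by (meson dvd_imp_le mod_less_divisor order_less_le_trans)
    then have "s (j0 + j mod r) = s (j mod r)" by (rule shift)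
    moreover have "s (j0 + j mod r) = s (j0 + j)" "s (j mod r) = s j"
      by (auto intro!: s_periodic simp: mod_simps)
    ultimately show ?thesis by simp
  qed
  then show ?thesis using least j0 by blast
qed

section \<open>The cyclic cover and centralizers in it\<close>

definition cover :: "int \<Rightarrow> fg_letter \<Rightarrow> 'a \<times> int \<Rightarrow> 'a \<times> int" where
  "cover N x pt = (a x (fst pt), (snd pt + weight x (fst pt)) mod N)"

text \<open>By \<open>weight_inv\<close> the reversed edge takes back the weight that the edge
  added, so inverse letters remain inverse on the cover.\<close>

lemma letter_action_cover:
  assumes "N > 0"
  shows "letter_action (S \<times> {0..<N}) (cover N)"
  using assms by unfold_locales (auto simp: cover_def act_closed act_inv weight_inv mod_simps)

lemma foldr_cover:
  assumes "t \<in> {0..<N}"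
  shows "foldr (cover N) w (p, t) = (foldr a w p, (t + path_weight w p) mod N)"
  using assms by (induction w) (auto simp: cover_def mod_simps add.assoc)

text \<open>Pigeonhole gives two equal vertices. Equal vertices have equal predecessors, so walking
  back yields a return to \<open>P 0\<close>; equal successors then make the return time a period of
  \<open>P\<close>.\<close>

lemma loop_closes:
  assumes "finite S"
  shows "\<exists>l>0. \<forall>i. P (l * i) = P 0"
proof -
  have "\<not> inj P"
    using assms P_closed by (metis finite_imageD finite_subset image_subsetI infinite_UNIV_nat)
  then obtain i j where "P i = P j" "i < j"
    using linorder_injI by blast
  from this have "P (j - i) = P 0"
  proof (induction i arbitrary: j)
    case (Suc i)
    then obtain j' where j': "j = Suc j'" by (cases j) auto
    then have "P i = P j'" "i < j'" using Suc.prems P_pred_cong[of i j'] by auto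
    then show ?case using Suc.IH j' by (metis diff_Suc_Suc)
  qed simp
  then have period: "P (j - i + b) = P b" for b
  proof (induction b)
    case (Suc b)
    then show ?case using P_Suc_cong[of "j - i + b" b] by simp
  qed simp
  have "P ((j - i) * b) = P 0" for b
  proof (induction b)
    case (Suc b)
    then show ?case using period[of "(j - i) * b"] by (metis mult_Suc_right)
  qed (metis mult_0_right)
  moreover have "j - i > 0" using \<open>i < j\<close> by simp
  ultimately show ?thesis by blast
qed

lemma centralizer_on_loop:
  assumes fin: "finite S" and r: "r > 0"
    and least: "\<And>i. (\<And>j. s (i + j) = s j) \<Longrightarrow> r dvd i"
    and L: "r dvd L" "L > 0"
  shows "\<exists>N>0. \<forall>h. (\<forall>pt\<in>S \<times> {0..<N}.
            foldr (cover N) h (foldr (cover N) (map s [0..<L]) pt) =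
            foldr (cover N) (map s [0..<L]) (foldr (cover N) h pt)) \<longrightarrow>
          (\<exists>j. r dvd j \<and> foldr a h (P 0) = P j)"
proof -
  obtain T where T: "T > 0" "\<And>i. P (T * i) = P 0" using loop_closes[OF fin] by blast
  \<comment> \<open>A multiple of \<open>L\<close>, so that the word of length \<open>l\<close> is a
    power of the given one and also commutes with \<open>h\<close>; a multiple of \<open>T\<close>,
    so that it closes up at \<open>P 0\<close>.\<close>
  define l where "l = T * L"
  have l: "l > 0" "r dvd l" "P l = P 0" using T L by (auto simp: l_def)
  \<comment> \<open>The two weights compared below differ by at most \<open>2 * l\<close>, so their
    congruence modulo \<open>N\<close> is an equality.\<close>
  define N where "N = 2 * int l + 1"
  have N: "N > 0" by (simp add: N_def)
  interpret cover: letter_action "S \<times> {0..<N}" "cover N" by (rule letter_action_cover[OF N])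
  show ?thesis
  proof (rule exI[of _ N], intro conjI allI impI N)
    fix h
    assume comm: "\<forall>pt\<in>S \<times> {0..<N}.
            foldr (cover N) h (foldr (cover N) (map s [0..<L]) pt) =
            foldr (cover N) (map s [0..<L]) (foldr (cover N) h pt)"
    have comm_pow: "foldr (cover N) h (foldr (cover N) (map s [0..<i * L]) pt) =
            foldr (cover N) (map s [0..<i * L]) (foldr (cover N) h pt)"
      if "pt \<in> S \<times> {0..<N}" for i pt
      using that
    proof (induction i arbitrary: pt)
      case (Suc i)
      have "map s [i * L..<Suc i * L] = map s [0..<L]"
      proof (rule nth_equalityI)
        have "(i * L + j) mod r = j mod r" for j
          using L(1) by (metis dvd_mult dvd_imp_mod_0 mod_add_left_eq add_0)
        then show "map s [i * L..<Suc i * L] ! j = map s [0..<L] ! j"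
          if "j < length (map s [i * L..<Suc i * L])" for j
          using that by (auto intro: s_periodic)
      qed simp
      then have split: "map s [0..<Suc i * L] = map s [0..<i * L] @ map s [0..<L]"
        using upt_add_eq_append[of 0 "i * L" L] by (simp add: add.commute)
      show ?case
        using Suc cover.foldr_closed[OF Suc.prems] bspec[OF comm Suc.prems] unfolding split by simp
    qed simp
    define c where "c = map s [0..<l]"
    define q where "q = foldr a h (P 0)"
    have "foldr (cover N) h (foldr (cover N) c (P 0, 0)) =
          foldr (cover N) c (foldr (cover N) h (P 0, 0))"
      unfolding c_def l_def using comm_pow N P_closed by simp
    moreover have "foldr a c (P 0) = P 0" "path_weight c (P 0) = int l"
      using foldr_loop[of 0 l] path_weight_loop[of l] l(3) by (auto simp: c_def)
    \<comment> \<open>Comparison of second coordinates: the weight of \<open>h\<close> cancels,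
      leaving the weight \<open>l\<close> of \<open>c\<close> at \<open>P 0\<close> against its
      weight at \<open>q\<close>.\<close>
    ultimately have "(int l + path_weight h (P 0)) mod N =
        (path_weight h (P 0) + path_weight c q) mod N"
      using N by (simp add: foldr_cover q_def mod_simps)
    then have "N dvd int l - path_weight c q" by (simp add: mod_eq_dvd_iff)
    then have "int l - path_weight c q = 0 \<or> \<bar>N\<bar> \<le> \<bar>int l - path_weight c q\<bar>"
      using dvd_imp_le_int by blast
    moreover have "\<bar>path_weight c q\<bar> \<le> int l"
      using abs_path_weight_le[of c q] by (simp add: c_def)
    ultimately have "path_weight c q = int l" by (auto simp: N_def)
    then show "\<exists>j. r dvd j \<and> foldr a h (P 0) = P j"
      using full_weight_path[OF l(2,1) r least] unfolding c_def q_def by blast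
  qed
qed

end

section \<open>The labelled circle, least periods and the regular action\<close>

lemma circle_action:
  fixes s :: "nat \<Rightarrow> fg_letter"
  assumes M: "M > 0"
    and per: "\<And>i j. i mod M = j mod M \<Longrightarrow> s i = s j"
    and red: "\<And>j. s (Suc j) \<noteq> fg_inv_letter (s j)"
  obtains a where "letter_action {..<M} a" "\<And>j. a (s j) (Suc j mod M) = j mod M"
proof -
  \<comment> \<open>One relation per generator, formed by the circle edges that carry it; edges
    labelled by its inverse are entered reversed.\<close>
  define R where "R i = {(Suc j mod M, j mod M) | j. s j = (False, i)} \<union>
                        {(j mod M, Suc j mod M) | j. s j = (True, i)}" for i
  have R_iff: "(x, y) \<in> R i \<longleftrightarrow> (\<exists>j. s j = (False, i) \<and> x = Suc j mod M \<and> y = j mod M) \<or>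
      (\<exists>j. s j = (True, i) \<and> x = j mod M \<and> y = Suc j mod M)" for x y i
    by (auto simp: R_def)
  \<comment> \<open>Edges of opposite sign in \<open>R i\<close> with a common source or target
    would carry consecutive, mutually inverse labels. For edges of equal sign either end determines
    the other. So \<open>R i\<close> and its converse are single-valued.\<close>
  have neq: "Suc j mod M \<noteq> j' mod M" if "s j = (b, i)" "s j' = (\<not> b, i)" for j j' b i
    using per[of "Suc j" j'] red[of j] that by (auto simp: fg_inv_letter_def)
  have neq1: "Suc j mod M \<noteq> j' mod M" if "s j = (False, i)" "s j' = (True, i)" for j j' i
    using neq[of j False i j'] that by simp
  have neq2: "Suc j mod M \<noteq> j' mod M" if "s j = (True, i)" "s j' = (False, i)" for j j' i
    using neq[of j True i j'] that by simp
  have suc: "Suc i mod M = Suc j mod M" if "i mod M = j mod M" for i j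
    using that by (metis mod_Suc_eq)
  have "\<exists>\<pi>. bij_betw \<pi> {..<M} {..<M} \<and> (\<forall>x y. (x, y) \<in> R i \<longrightarrow> \<pi> x = y)" for i
  proof (rule extend_partial_injection)
    show "R i \<subseteq> {..<M} \<times> {..<M}" using M by (auto simp: R_def)
    show "single_valued (R i)"
    proof (rule single_valuedI)
      fix x y z assume "(x, y) \<in> R i" "(x, z) \<in> R i"
      then show "y = z"
        unfolding R_iff converse_iff by (metis mod_Suc_cancel suc neq1)
    qed
    show "single_valued ((R i)\<inverse>)"
    proof (rule single_valuedI)
      fix x y z assume "(x, y) \<in> (R i)\<inverse>" "(x, z) \<in> (R i)\<inverse>"
      then show "y = z"
        unfolding R_iff converse_iff by (metis mod_Suc_cancel suc neq2)
    qed
  qed blast+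
  then obtain \<pi> where \<pi>: "\<And>i. bij_betw (\<pi> i) {..<M} {..<M}" "\<And>i x y. (x, y) \<in> R i \<Longrightarrow> \<pi> i x = y"
    by metis
  define a where "a x = (if fst x then inv_into {..<M} (\<pi> (snd x)) else \<pi> (snd x))" for x :: fg_letter
  have "a x p \<in> {..<M} \<and> a (fg_inv_letter x) (a x p) = p" if "p \<in> {..<M}" for x p
    using that \<pi>(1)[of "snd x"] bij_betw_inv_into[OF \<pi>(1)[of "snd x"]]
      bij_betw_inv_into_left[OF \<pi>(1)[of "snd x"]] bij_betw_inv_into_right[OF \<pi>(1)[of "snd x"]]
    by (auto simp: a_def fg_inv_letter_def dest: bij_betwE)
  then have "letter_action {..<M} a" by unfold_locales auto
  moreover have "a (s j) (Suc j mod M) = j mod M" for j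
  proof (cases "s j")
    case (Pair b i)
    show ?thesis
    proof (cases b)
      case True
      then have "\<pi> i (j mod M) = Suc j mod M" using Pair by (intro \<pi>(2)) (auto simp: R_def)
      then show ?thesis
        using bij_betw_inv_into_left[OF \<pi>(1)[of i], of "j mod M"] True Pair M by (auto simp: a_def)
    next
      case False
      then have "\<pi> i (Suc j mod M) = j mod M" using Pair by (intro \<pi>(2)) (auto simp: R_def)
      then show ?thesis using False Pair by (auto simp: a_def)
    qed
  qed
  ultimately show ?thesis using that by blast
qed

text \<open>The least positive period divides every period, because a nonzero remainder would be a
  smaller one.\<close>

lemma periodic_least:
  fixes s :: "nat \<Rightarrow> 'a"
  assumes "L > 0" "\<And>j. s (L + j) = s j"
  obtains r where "r > 0" "\<And>i. (\<And>j. s (i + j) = s j) \<Longrightarrow> r dvd i"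
    "\<And>i j. i mod r = j mod r \<Longrightarrow> s i = s j"
proof -
  define r where "r = (LEAST r. r > 0 \<and> (\<forall>j. s (r + j) = s j))"
  have r: "r > 0" "\<And>j. s (r + j) = s j"
    using LeastI[of "\<lambda>r. r > 0 \<and> (\<forall>j. s (r + j) = s j)" L] assms unfolding r_def by auto
  have mult: "s (r * q + j) = s j" for q j
    by (induction q) (auto simp: r(2) add.assoc)
  have cong: "s i = s (i mod r)" for i
    using mult[of "i div r" "i mod r"] by simp
  show ?thesis
  proof
    show "r > 0" by (rule r(1))
    show "s i = s j" if "i mod r = j mod r" for i j
      using cong that by metis
    show "r dvd i" if i: "\<And>j. s (i + j) = s j" for i
    proof (rule ccontr)
      assume "\<not> r dvd i"
      then have "i mod r > 0" by (simp add: dvd_eq_mod_eq_0)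
      have "s (i mod r + j) = s j" for j
      proof -
        have "s (i mod r + j) = s (r * (i div r) + (i mod r + j))" by (rule mult[symmetric])
        also have "\<dots> = s (i + j)" by (metis add.assoc mult_div_mod_eq)
        finally show ?thesis using i by simp
      qed
      then have "r \<le> i mod r"
        unfolding r_def using \<open>i mod r > 0\<close> r_def by (intro Least_le) auto
      then show False using r(1) by (meson mod_less_divisor not_less)
    qed
  qed
qed

lemma fg_reduced_nth: "fg_reduced w \<Longrightarrow> Suc i < length w \<Longrightarrow> w ! Suc i \<noteq> fg_inv_letter (w ! i)"
  by (induction w arbitrary: i rule: fg_reduced.induct) (auto simp: nth_Cons split: nat.splits)

lemma fg_reduced_map:
  assumes "\<And>j. s (Suc j) \<noteq> fg_inv_letter (s j)"
  shows "fg_reduced (map s [0..<n])"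
proof (induction n)
  case (Suc n)
  then show ?case using assms[of "n - 1"] by (cases n) (auto simp: fg_reduced_append last_map)
qed simp

text \<open>The left regular action of the permutation group generated by an action on \<open>V\<close>,
  extended to all functions.\<close>

definition regular_action :: "'a set \<Rightarrow> (fg_letter \<Rightarrow> 'a \<Rightarrow> 'a) \<Rightarrow> fg_letter \<Rightarrow> ('a \<Rightarrow> 'a) \<Rightarrow> 'a \<Rightarrow> 'a"
  where "regular_action V a x f = restrict (a x \<circ> f) V"

context letter_action
begin

lemma letter_action_regular: "letter_action (S \<rightarrow>\<^sub>E S) (regular_action S a)"
proof
  fix f x assume f: "f \<in> S \<rightarrow>\<^sub>E S"
  then show "regular_action S a x f \<in> S \<rightarrow>\<^sub>E S"
    by (auto simp: regular_action_def intro!: act_closed)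
  show "regular_action S a (fg_inv_letter x) (regular_action S a x f) = f"
  proof
    fix p show "regular_action S a (fg_inv_letter x) (regular_action S a x f) p = f p"
      using f by (cases "p \<in> S") (auto simp: regular_action_def intro!: act_inv)
  qed
qed

text \<open>The image of the identity records the whole permutation given by a word, so an equation
  at this one point of the regular action holds at every point of \<open>S\<close>.\<close>

lemma foldr_regular_id:
  "p \<in> S \<Longrightarrow> foldr (regular_action S a) w (\<lambda>q\<in>S. q) p = foldr a w p"
  by (induction w) (auto simp: regular_action_def)

end

section \<open>Cyclically reduced words\<close>

lemma foldr_power:
  assumes "letter_action S a" "p \<in> S"
  shows "foldr a (h [^]\<^bsub>free_group k\<^esub> (n::nat)) p = (foldr a h ^^ n) p"
proof -
  interpret letter_action S a by (rule assms(1))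
  show ?thesis using assms(2)
  proof (induction n arbitrary: p)
    case (Suc n)
    then show ?case
      by (simp add: foldr_free_mult foldr_closed funpow_swap1 del: funpow.simps(2))
         (simp add: funpow_Suc_right del: funpow.simps(2))
  qed (simp add: one_free_group)
qed

text \<open>In the proof, \<open>map s [0..<r]\<close> is the primitive root \<open>u\<close>,
  \<open>c\<close> is its \<open>d\<close>-th power, and the circle of \<open>M\<close> vertices is
  labelled by \<open>n\<close> copies of \<open>u\<close>.\<close>

lemma power_if_cyclically_reduced:
  assumes c: "c \<in> carrier (free_group k)" "c \<noteq> []" "hd c \<noteq> fg_inv_letter (last c)"
    and pow: "power_in_finite_quotients k m c"
  shows "\<exists>w\<in>carrier (free_group k). c = w [^]\<^bsub>free_group k\<^esub> m"
proof -
  define t where "t = nat \<bar>m\<bar>"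
  define L where "L = length c"
  define s where "s j = c ! (j mod L)" for j
  have L: "L > 0" using c(2) by (simp add: L_def)
  have c_eq: "c = map s [0..<L]"
    by (rule nth_equalityI) (auto simp: L_def s_def)
  have s_in: "s j \<in> set c" for j using L by (simp add: s_def L_def)
  \<comment> \<open>Only the seam between the last and the first letter of \<open>c\<close> uses the
    cyclic condition; elsewhere \<open>c\<close> itself is reduced.\<close>
  have red: "s (Suc j) \<noteq> fg_inv_letter (s j)" for j
  proof (cases "Suc (j mod L) = L")
    case True
    then have "j mod L = L - 1" by simp
    then have "s (Suc j) = hd c" "s j = last c"
      using c(2) True by (auto simp: s_def mod_Suc hd_conv_nth last_conv_nth L_def)
    then show ?thesis using c(3) by simp
  next
    case False
    moreover have "j mod L < L" using L by simp
    ultimately have "Suc (j mod L) < L" by simp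
    then show ?thesis
      using False fg_reduced_nth[of c "j mod L"] c(1)
      by (simp add: s_def mod_Suc L_def carrier_free_group)
  qed
  obtain r where r: "r > 0" and least: "\<And>i. (\<And>j. s (i + j) = s j) \<Longrightarrow> r dvd i"
    and per: "\<And>i j. i mod r = j mod r \<Longrightarrow> s i = s j"
  proof -
    have "s (L + j) = s j" for j by (simp add: s_def)
    from periodic_least[of L s, OF L this] show ?thesis using that by blast
  qed
  have "r dvd L" by (rule least) (simp add: s_def)
  then obtain d where d: "L = r * d" by blast
  have d0: "d > 0" using L d by (cases d) auto
  \<comment> \<open>This choice makes \<open>n dvd d + t * y\<close> imply both \<open>t > 0\<close> and \<open>t dvd d\<close>.\<close>
  define n where "n = (if t = 0 then d + 1 else t)"
  define M where "M = r * n"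
  have n: "n > 0" by (simp add: n_def)
  then have M: "M > 0" using r by (simp add: M_def)
  have perM: "s i = s j" if "i mod M = j mod M" for i j
    using that by (intro per) (metis M_def mod_mod_cancel dvd_triv_left)
  obtain a0 where act0: "letter_action {..<M} a0"
    and step0: "\<And>j. a0 (s j) (Suc j mod M) = j mod M"
    using circle_action[of M s] M perM red by blast
  interpret V: labelled_loop "{..<M}" a0 s "\<lambda>j. j mod M" r
  proof (intro labelled_loop.intro act0 labelled_loop_axioms.intro per red step0)
    show "i mod r = j mod r" if "i mod M = j mod M" for i j
      using that by (metis M_def mod_mod_cancel dvd_triv_left)
  qed (use M in auto)
  define Q where "Q = {..<M} \<rightarrow>\<^sub>E {..<M}"
  define a where "a = regular_action {..<M} a0"
  \<comment> \<open>The path starts at the identity and follows inverse letters, because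
    \<open>s j\<close> has to lead from \<open>P (Suc j)\<close> back to \<open>P j\<close>.\<close>
  define P where "P j = foldr a (fg_inv_word (map s [0..<j])) (\<lambda>p\<in>{..<M}. p)" for j
  interpret Q0: letter_action Q a unfolding Q_def a_def by (rule V.letter_action_regular)
  have P_Suc: "P (Suc j) = a (fg_inv_letter (s j)) (P j)" for j
    by (simp add: P_def fg_inv_word_def)
  have id_Q: "(\<lambda>p\<in>{..<M}. p) \<in> Q" by (auto simp: Q_def)
  have P_Q: "P j \<in> Q" for j unfolding P_def using id_Q by (rule Q0.foldr_closed)
  \<comment> \<open>As a permutation, \<open>P j\<close> translates the multiples of
    \<open>r\<close> by \<open>j\<close>, since the labels seen from \<open>i * r\<close> are those
    seen from 0. The value at 0 later yields \<open>P_inj\<close>.\<close>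
  have P_at: "P j (i * r mod M) = (i * r + j) mod M" for i j
  proof (induction j)
    case 0
    then show ?case using M by (simp add: P_def fg_inv_word_def)
  next
    case (Suc j)
    have "s j = s (i * r + j)" by (rule per) simp
    then show ?case
      using Suc M V.P_step_inv[of "i * r + j"] by (simp add: P_Suc a_def regular_action_def)
  qed
  interpret Q: labelled_loop Q a s P r
  proof (intro labelled_loop.intro Q0.letter_action_axioms labelled_loop_axioms.intro per red P_Q)
    show "a (s j) (P (Suc j)) = P j" for j
      using Q0.act_inv'[OF P_Q] by (simp add: P_Suc)
    show "i mod r = j mod r" if "P i = P j" for i j
      using P_at[of i 0] P_at[of j 0] that by (intro V.P_inj) simp
  qed
  have "finite Q" unfolding Q_def by (intro finite_PiE) auto
  from Q.centralizer_on_loop[OF this r least \<open>r dvd L\<close> L] c_eq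
  obtain N where N: "N > 0" and central: "\<And>h. (\<And>pt. pt \<in> Q \<times> {0..<N} \<Longrightarrow>
            foldr (Q.cover N) h (foldr (Q.cover N) c pt) =
            foldr (Q.cover N) c (foldr (Q.cover N) h pt)) \<Longrightarrow>
          \<exists>j. r dvd j \<and> foldr a h (P 0) = P j"
    by auto
  interpret W: letter_action "Q \<times> {0..<N}" "Q.cover N" by (rule Q.letter_action_cover[OF N])
  have "finite (Q \<times> {0..<N})" using \<open>finite Q\<close> by simp
  from W.power_on_finite_action[OF this pow c(1)]
  obtain h where h: "h \<in> carrier (free_group k)"
    "\<And>pt. pt \<in> Q \<times> {0..<N} \<Longrightarrow>
       foldr (Q.cover N) c pt = foldr (Q.cover N) (h [^]\<^bsub>free_group k\<^esub> t) pt"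
    unfolding t_def by blast
  \<comment> \<open>On the cover \<open>c\<close> acts as a power of \<open>h\<close>, hence
    commutes with it.\<close>
  have "foldr (Q.cover N) h (foldr (Q.cover N) c pt) = foldr (Q.cover N) c (foldr (Q.cover N) h pt)"
    if "pt \<in> Q \<times> {0..<N}" for pt
    using that
    by (simp add: h(2) W.foldr_closed foldr_power[OF W.letter_action_axioms] funpow_swap1)
  then obtain j where j: "r dvd j" "foldr a h (P 0) = P j" using central by blast
  obtain y where y: "j = y * r" using j(1) by (metis dvd_div_mult_self)
  have P0: "P 0 = (\<lambda>p\<in>{..<M}. p)" by (simp add: P_def fg_inv_word_def)
  \<comment> \<open>The equation for \<open>P j\<close> is one of permutations, so \<open>h\<close>
    translates all multiples of \<open>r\<close> on the circle by the same \<open>j\<close>.\<close>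
  have h_at: "foldr a0 h (i * r mod M) = (i + y) * r mod M" for i
  proof -
    have "foldr a0 h (i * r mod M) = foldr a h (P 0) (i * r mod M)"
      unfolding P0 a_def using M by (subst V.foldr_regular_id) auto
    also have "\<dots> = (i * r + j) mod M" using j(2) P_at by simp
    finally show ?thesis by (simp add: y algebra_simps)
  qed
  have ht_at: "(foldr a0 h ^^ x) (i * r mod M) = (i + x * y) * r mod M" for x i
  proof (induction x)
    case (Suc x)
    then show ?case using h_at[of "i + x * y"] by (simp add: algebra_simps)
  qed simp
  have c_at: "foldr a0 c (L mod M) = 0"
    using V.foldr_loop[of 0 L] c_eq by simp
  have "foldr a0 c p = (foldr a0 h ^^ t) p" if "p \<in> {..<M}" for p
  proof -
    have "foldr a c (P 0) = foldr a (h [^]\<^bsub>free_group k\<^esub> t) (P 0)"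
      using h(2)[of "(P 0, 0)"] P_Q N by (simp add: Q.foldr_cover)
    then show ?thesis
      using that V.foldr_regular_id[of p c] V.foldr_regular_id[of p "h [^]\<^bsub>free_group k\<^esub> t"]
        foldr_power[OF act0] by (simp add: P0 a_def)
  qed
  \<comment> \<open>The word \<open>c\<close> takes \<open>d * r\<close> to 0, while
    \<open>t\<close> applications of \<open>h\<close> take it to \<open>(d + t * y) * r\<close>. The
    plus sign arises because \<open>P\<close> runs along inverse letters, so \<open>h\<close> moves
    against \<open>u\<close>.\<close>
  then have "(foldr a0 h ^^ t) (d * r mod M) = 0"
    using c_at M by (simp add: d mult.commute)
  then have "n * r dvd (d + t * y) * r"
    using ht_at[of t d] by (simp add: M_def mult.commute dvd_eq_mod_eq_0)
  then have dvd: "n dvd d + t * y" using r by simp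
  have t0: "t > 0"
  proof (rule ccontr)
    assume "\<not> t > 0"
    then have "d + 1 dvd d" using dvd by (simp add: n_def)
    then show False using d0 by (auto dest: dvd_imp_le)
  qed
  then have "t dvd d" using dvd by (simp add: n_def dvd_add_left_iff)
  then obtain e where e: "d = t * e" by blast
  define w where "w = map s [0..<e * r]"
  have word_in: "map s [0..<l] \<in> carrier (free_group k)" for l
    using s_in c(1) fg_reduced_map[of s, OF red] by (fastforce simp: carrier_free_group)
  \<comment> \<open>Copies of \<open>w\<close> join without cancellation because all of
    \<open>s\<close> is reduced, so powers are concatenations.\<close>
  have "w [^]\<^bsub>free_group k\<^esub> i = map s [0..<i * (e * r)]" for i :: nat
  proof (induction i)
    case (Suc i)
    have "s (i * (e * r) + b) = s b" for b by (rule per) (simp add: mult.assoc[symmetric])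
    then have "map s [i * (e * r)..<i * (e * r) + e * r] = map s [0..<e * r]"
      by (intro nth_equalityI) auto
    then have "map s [0..<i * (e * r)] @ w = map s [0..<Suc i * (e * r)]"
      using upt_add_eq_append[of 0 "i * (e * r)" "e * r"] by (simp add: w_def add.commute)
    then show ?case
      using Suc fg_reduced_map[of s, OF red] by (simp add: mult_free_group fg_reduce_reduced)
  qed (simp add: one_free_group)
  then have "w [^]\<^bsub>free_group k\<^esub> t = c"
    using c_eq by (simp add: d e mult.commute mult.left_commute)
  moreover have "w \<in> carrier (free_group k)" unfolding w_def by (rule word_in)
  ultimately show ?thesis
    using free.nat_pow_eq_int_pow[of w k m] by (auto simp: t_def)
qed

text \<open>If the outer letters are mutually inverse, removing them is a conjugation and shortens
  the word; otherwise the word is empty or cyclically reduced.\<close>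

lemma power_if_power_in_finite_quotients:
  assumes "g \<in> carrier (free_group k)" "power_in_finite_quotients k m g"
  shows "\<exists>h\<in>carrier (free_group k). g = h [^]\<^bsub>free_group k\<^esub> m"
  using assms
proof (induction "length g" arbitrary: g rule: less_induct)
  case less
  consider "g = []" | "g \<noteq> []" "hd g \<noteq> fg_inv_letter (last g)"
    | "g \<noteq> []" "hd g = fg_inv_letter (last g)" by blast
  then show ?case
  proof cases
    case 1
    then have "g = \<one>\<^bsub>free_group k\<^esub> [^]\<^bsub>free_group k\<^esub> m"
      by (metis free.int_pow_one one_free_group)
    then show ?thesis by blast
  next
    case 2
    then show ?thesis using less.prems power_if_cyclically_reduced by blast
  next
    case 3
    define x where "x = hd g"
    \<comment> \<open>A letter is never its own inverse, so \<open>g\<close> has at least two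
      letters.\<close>
    have "tl g \<noteq> []" using 3 by (cases g) auto
    define g' where "g' = butlast (tl g)"
    have "last g = fg_inv_letter x" using 3 by (simp add: x_def)
    then have g: "g = x # g' @ [fg_inv_letter x]"
      using 3 \<open>tl g \<noteq> []\<close> unfolding g'_def x_def
      by (metis append_butlast_last_id last_tl list.collapse)
    have x: "[x] \<in> carrier (free_group k)"
      using less.prems(1) g by (simp add: carrier_free_group)
    have g': "g' \<in> carrier (free_group k)"
      using less.prems(1) g by (auto simp: carrier_free_group fg_reduced_Cons fg_reduced_append)
    have g_conj: "g = [x] \<otimes>\<^bsub>free_group k\<^esub> g' \<otimes>\<^bsub>free_group k\<^esub> inv\<^bsub>free_group k\<^esub> [x]"
    proof -
      have "fg_reduced ([x] @ g')" "fg_reduced (([x] @ g') @ [fg_inv_letter x])"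
        using less.prems(1) g
        by (auto simp: carrier_free_group fg_reduced_Cons fg_reduced_append hd_append)
      then show ?thesis
        using x g by (simp add: inv_fg_letter carrier_free_group mult_free_group fg_reduce_reduced)
    qed
    then have "power_in_finite_quotients k m g'"
      using less.prems(2) x g' power_in_finite_quotients_conjugate by metis
    then obtain h where h: "h \<in> carrier (free_group k)" "g' = h [^]\<^bsub>free_group k\<^esub> m"
      using less.hyps[of g'] g g' by auto
    then have "g = ([x] \<otimes>\<^bsub>free_group k\<^esub> h \<otimes>\<^bsub>free_group k\<^esub> inv\<^bsub>free_group k\<^esub> [x]) [^]\<^bsub>free_group k\<^esub> m"
      using g_conj x by (simp add: free.int_pow_conjugate)
    then show ?thesis using x h(1) by blast
  qed
qed

theorem mainTheorem1:
  fixes k :: nat and m :: int and g :: "fg_letter list"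
  assumes "k \<ge> 1"
    and "g \<in> carrier (free_group k)"
  shows "(\<exists>h \<in> carrier (free_group k). g = h [^]\<^bsub>free_group k\<^esub> m) \<longleftrightarrow>
         (\<forall>K. K \<lhd> free_group k \<and> finite (rcosets\<^bsub>free_group k\<^esub> K) \<longrightarrow>
              (\<exists>hK \<in> carrier (free_group k).
                  g <#\<^bsub>free_group k\<^esub> K = (hK [^]\<^bsub>free_group k\<^esub> m) <#\<^bsub>free_group k\<^esub> K))"
  \<comment> \<open>For the forward direction the same root serves in every quotient.\<close>
  using power_if_power_in_finite_quotients[OF assms(2)]
  unfolding power_in_finite_quotients_def by blast

end
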